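(* Let $S:\{1,2,3,\dots\}\to\mathbb{R}$ be a function satisfying the following two axioms. (i) $S$ is positive and increasing, in the sense that $S(W)>0$ for every integer $W\ge 2$ and $S(W)\le S(W+1)$ for every integer $W\ge 1$. (ii) $S$ is additive, in the sense that $S(W_1\cdot W_2)=S(W_1)+S(W_2)$ for all integers $W_1,W_2\ge 1$. Then there exists a constant $k>0$ such that $S(W)=k\ln W$ for every integer $W\ge 1$.
   Context: Here $W$ is the thermodynamic probability (statistical weight, or "degree of disorder") of a system, i.e. the total number of microscopic states compatible with its macroscopic state, so $W$ is a positive integer. $S(W)$ is the entropy of a system with degree of disorder $W$. The composite of two statistically independent systems with degrees of disorder $W_1$ and $W_2$ has degree of disorder $W_1\cdot W_2$. The constant $k$ depends on the unit of measurement of entropy, and $\ln$ denotes the natural logarithm. *)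

theory Defs
  imports Complex_Main
begin

end

theory Submission
  imports Defs
begin

text \<open>
  Squeeze \<open>W ^ n\<close> between consecutive powers of \<open>2\<close>, say \<open>2 ^ m \<le> W ^ n < 2 ^ (m + 1)\<close>. Both \<open>S\<close> and
  \<open>(S 2 / ln 2) * ln\<close> are monotone and additive and agree at \<open>2\<close>, so \<open>n\<close> times their values at \<open>W\<close>
  lie in the same interval of length \<open>S 2\<close>. Letting \<open>n\<close> grow forces them to coincide.
\<close>

lemma additive_power:
  fixes S :: "nat \<Rightarrow> real"
  assumes additive: "\<And>a b. a \<ge> 1 \<Longrightarrow> b \<ge> 1 \<Longrightarrow> S (a * b) = S a + S b"
    and "W \<ge> 1"
  shows "S (W ^ n) = real n * S W"
proof (induction n)
  case 0
  \<comment> \<open>Since \<open>1 * 1 = 1\<close>, additivity forces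
    \<open>S 1 = 0\<close>.\<close>
  show ?case using additive[of 1 1] by simp
next
  case (Suc n)
  then show ?case using additive[of W "W ^ n"] \<open>W \<ge> 1\<close> by (simp add: algebra_simps)
qed

text \<open>Monotonicity carries the inequalities over to \<open>S\<close>, and additivity turns
  powers into multiples. \<open>S\<close> is kept general so that the bounds serve both the entropy
  and its logarithmic candidate.\<close>

lemma mono_additive_power_bounds:
  fixes S :: "nat \<Rightarrow> real"
  assumes mono: "\<And>a b. 1 \<le> a \<Longrightarrow> a \<le> b \<Longrightarrow> S a \<le> S b"
    and additive: "\<And>a b. a \<ge> 1 \<Longrightarrow> b \<ge> 1 \<Longrightarrow> S (a * b) = S a + S b"
    and "W \<ge> 1" "2 ^ m \<le> W ^ n" "W ^ n < 2 ^ (m + 1)"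
  shows "real m * S 2 \<le> real n * S W" "real n * S W \<le> (real m + 1) * S 2"
proof -
  note pow = additive_power[of S, OF additive]
  show "real m * S 2 \<le> real n * S W"
    using mono[of "2 ^ m" "W ^ n"] assms(3-4) by (simp add: pow del: power_Suc)
  have "S (W ^ n) \<le> S (2 ^ (m + 1))"
    using mono[of "W ^ n" "2 ^ (m + 1)"] assms(3,5) by simp
  then show "real n * S W \<le> (real m + 1) * S 2"
    using pow[of W n] pow[of 2 "m + 1"] \<open>W \<ge> 1\<close> by (simp add: add.commute)
qed

text \<open>Archimedean property: the multiples of a positive number exceed every fixed
  bound.\<close>

lemma eq_0_if_multiples_bounded:
  fixes x c :: real
  assumes bounded: "\<And>n::nat. real n * \<bar>x\<bar> \<le> c"
  shows "x = 0"
proof (rule ccontr)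
  assume "x \<noteq> 0"
  then obtain n :: nat where "c < real n * \<bar>x\<bar>"
    using ex_less_of_nat_mult[of "\<bar>x\<bar>" c] by auto
  with bounded[of n] show False by simp
qed

theorem mainTheorem1:
  fixes S :: "nat \<Rightarrow> real"
  assumes positive: "\<And>W::nat. W \<ge> 2 \<Longrightarrow> S W > 0"
    and increasing: "\<And>W::nat. W \<ge> 1 \<Longrightarrow> S W \<le> S (W + 1)"
    and additive: "\<And>W1 W2::nat. W1 \<ge> 1 \<Longrightarrow> W2 \<ge> 1 \<Longrightarrow> S (W1 * W2) = S W1 + S W2"
  shows "\<exists>k::real. k > 0 \<and> (\<forall>W::nat. W \<ge> 1 \<longrightarrow> S W = k * ln (real W))"
proof -
  \<comment> \<open>The desired equation at \<open>W = 2\<close> forces this value.\<close>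
  define k where "k = S 2 / ln 2"
  define L where "L W = k * ln (real W)" for W :: nat
  have "k > 0" using positive[of 2] by (simp add: k_def)
  have L2: "L 2 = S 2" by (simp add: L_def k_def)
  have mono_S: "S a \<le> S b" if "1 \<le> a" "a \<le> b" for a b
    using that(2)
  proof (induction rule: dec_induct)
    case (step n)
    then show ?case using increasing[of n] that(1) by simp
  qed simp
  have mono_L: "L a \<le> L b" if "1 \<le> a" "a \<le> b" for a b
    using that \<open>k > 0\<close> by (simp add: L_def)
  have additive_L: "L (a * b) = L a + L b" if "1 \<le> a" "1 \<le> b" for a b
    using that by (simp add: L_def ln_mult distrib_left)
  have "S W = L W" if "W \<ge> 1" for W
  proof -
    have "real n * \<bar>S W - L W\<bar> \<le> S 2" for n
    proof -
      \<comment> \<open>Such an \<open>m\<close>, depending on \<open>n\<close>, exists because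
        \<open>W ^ n\<close> is at least \<open>1 = 2 ^ 0\<close>.\<close>
      obtain m where "2 ^ m \<le> W ^ n" "W ^ n < 2 ^ (m + 1)"
        using ex_power_ivl1[of 2 "W ^ n"] \<open>W \<ge> 1\<close> by auto
      note ivl = \<open>W \<ge> 1\<close> this
      \<comment> \<open>By \<open>L2\<close> both pairs of bounds have the same endpoints,
        \<open>m * S 2\<close> and \<open>(m + 1) * S 2\<close>; their distance \<open>S 2\<close>
        does not depend on \<open>n\<close>.\<close>
      have "\<bar>real n * S W - real n * L W\<bar> \<le> S 2"
        using mono_additive_power_bounds[of S, OF mono_S additive ivl]
          mono_additive_power_bounds[of L, OF mono_L additive_L ivl]
        by (simp add: L2 algebra_simps abs_le_iff)
      then show ?thesis by (simp add: abs_mult flip: right_diff_distrib)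
    qed
    from eq_0_if_multiples_bounded[OF this] show ?thesis by simp
  qed
  with \<open>k > 0\<close> show ?thesis by (auto simp: L_def)
qed

end
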